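(* Consider the partitioned optimization framework for the problem $(\mathrm{P}_{\mathrm{ini}})$: minimize $\varphi(y)$ over $y\in\mathbb{Y}$ subject to $y\in\Omega$, with partition $\mathbb{Y}=\bigsqcup_{x\in\mathbb{X}}\mathbb{Y}(x)$, set $X$ of effective partition indices, oracle function $\gamma:X\to Y$, index function $\chi:\mathbb{Y}\to\mathbb{X}$, and reformulated problem $(\mathrm{P}_{\mathrm{ref}})$: minimize $\Phi(x)$ over $x\in\mathbb{X}$ (all as defined in the context). Assume that $\chi$ is continuous, and that $X$ admits a partition $X=\bigsqcup_{i=1}^N X_i$, with $N\in\{1,2,\dots\}\cup\{+\infty\}$, such that for every $x\in\mathrm{cl}(X)$ there is a neighbourhood $\mathcal{X}\subseteq\mathbb{X}$ of $x$ for which $\{i: 1\le i\le N,\ X_i\cap\mathcal{X}\neq\emptyset\}$ is finite, and such that $\gamma_{|X_i}$ is uniformly continuous for every $i$. Then the following three statements hold: (a) for every global solution $x^*$ to $(\mathrm{P}_{\mathrm{ref}})$, $\gamma(x^* )$ is a global solution to $(\mathrm{P}_{\mathrm{ini}})$; (b) for every local solution $x^*\in X$ to $(\mathrm{P}_{\mathrm{ref}})$, $\gamma(x^* )$ is a local solution to $(\mathrm{P}_{\mathrm{ini}})$; (c) for every generalized local solution $x^*\in\mathrm{cl}(X)$ to $(\mathrm{P}_{\mathrm{ref}})$, the set $\mathcal{ACC}(\gamma;x^* )$ contains a generalized local solution to $(\mathrm{P}_{\mathrm{ini}})$.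
   Context: Notation. $\overline{\mathbb{R}}=\mathbb{R}\cup\{\pm\infty\}$; $\mathrm{cl}$ is closure. For a sequence $(b^k)_{k\in\mathbb{N}}$, $\mathrm{acc}((b^k)_{k\in\mathbb{N}})$ is the set of all its accumulation points (in $\overline{\mathbb{R}}$ for extended-real sequences). For a function $g$ defined on a subset $D$ of a normed space and a point $a$ of the space, $\mathcal{ACC}(g;a)$ is the union of $\mathrm{acc}((g(a^k))_{k\in\mathbb{N}})$ over all sequences $(a^k)_{k\in\mathbb{N}}\in D^{\mathbb{N}}$ converging to $a$. For $f:\mathbb{A}\to\overline{\mathbb{R}}$ and $A\subseteq\mathbb{A}$, the extreme barrier function $\overline{f}_A:\mathbb{A}\to\overline{\mathbb{R}}$ is $\overline{f}_A(a)=f(a)$ if $a\in A$ and $+\infty$ otherwise. When $N=+\infty$, the index $i$ ranges over all positive integers. Initial problem $(\mathrm{P}_{\mathrm{ini}})$. $\mathbb{Y}$ is a (possibly infinite-dimensional) Banach space, $\Omega\subseteq\mathbb{Y}$, and $\varphi:\mathbb{Y}\to\overline{\mathbb{R}}$ (possibly discontinuous) has effective domain $Y=\{y\in\mathbb{Y}:\varphi(y)\neq\pm\infty\}$ with $Y\cap\Omega\neq\emptyset$. The problem is to minimize $\varphi(y)$ over $y\in\mathbb{Y}$ subject to $y\in\Omega$. Partitioned optimization framework. $\mathbb{X}$ is a finite-dimensional normed space and $\mathbb{Y}=\bigsqcup_{x\in\mathbb{X}}\mathbb{Y}(x)$ is a partition (pairwise disjoint sets indexed by $\mathbb{X}$ with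 union $\mathbb{Y}$). The set of effective partition indices is $X=\{x\in\mathbb{X}:\mathbb{Y}(x)\cap Y\cap\Omega\neq\emptyset\}$. It is assumed that, for every $x\in X$, the subproblem of minimizing $\varphi(y)$ over $y\in\mathbb{Y}(x)$ subject to $y\in\Omega$ admits a nonempty set $\Gamma(x)\subseteq\mathbb{Y}(x)$ of global solutions. The oracle function $\gamma:X\to Y$ satisfies $\gamma(x)\in\Gamma(x)$ for every $x\in X$. The index function $\chi:\mathbb{Y}\to\mathbb{X}$ maps $y$ to the unique $x\in\mathbb{X}$ with $y\in\mathbb{Y}(x)$. The reformulated problem $(\mathrm{P}_{\mathrm{ref}})$ is to minimize $\Phi(x)$ over $x\in\mathbb{X}$ (no constraint), where $\Phi:\mathbb{X}\to\overline{\mathbb{R}}$ is $\Phi(x)=\varphi(\gamma(x))$ if $x\in X$ and $\Phi(x)=+\infty$ otherwise. Generalized local solution. For a normed space $\mathbb{A}$, $A\subseteq\mathbb{A}$ and $f:\mathbb{A}\to\overline{\mathbb{R}}$, a point $a^*\in\mathrm{cl}(A)$ is a generalized local solution to the problem of minimizing $f(a)$ over $a\in\mathbb{A}$ subject to $a\in A$ if there is a neighbourhood $\mathcal{A}^*\subseteq\mathbb{A}$ of $a^*$ such that $\inf\overline{f}_A(\mathcal{A}^* )=\inf\mathcal{ACC}(\overline{f}_A;a^* )$. (For $(\mathrm{P}_{\mathrm{ref}})$, $A=\mathbb{X}$, so the barrier function is $\Phi$ itself.) Global and local solutions have their usual meaning (feasible points minimizing the objective over the feasible set, respectively over the intersection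 of the feasible set with some neighbourhood of the point).
   Formalization: Statements (a) and (b) are proved under the added assumption that φ does not take the value −∞ on Ω; without it both can fail, since Φ is +∞ at indices outside X even where φ = −∞ on Y(x)∩Ω. Statement (c) needs no such assumption. *)

theory Defs
  imports "HOL-Analysis.Analysis" "HOL-Library.Extended_Nat"
begin

definition acc_seq :: "(nat \<Rightarrow> 'a::topological_space) \<Rightarrow> 'a set" where
  "acc_seq b = {l. \<exists>r. strict_mono r \<and> (b \<circ> r) \<longlonglongrightarrow> l}"

definition ACC :: "'a::topological_space set \<Rightarrow> ('a \<Rightarrow> 'b::topological_space) \<Rightarrow> 'a \<Rightarrow> 'b set" where
  "ACC D g a = (\<Union>s \<in> {s. range s \<subseteq> D \<and> s \<longlonglongrightarrow> a}. acc_seq (g \<circ> s))"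

definition barrier :: "('a \<Rightarrow> ereal) \<Rightarrow> 'a set \<Rightarrow> 'a \<Rightarrow> ereal" where
  "barrier f A a = (if a \<in> A then f a else \<infinity>)"

text \<open>
  The solution notions below refer to the problem of minimizing \<open>f\<close> subject to membership
  in \<open>A\<close>. A neighbourhood of a point is any set having the point in its interior.
\<close>

definition global_solution :: "('a \<Rightarrow> ereal) \<Rightarrow> 'a set \<Rightarrow> 'a \<Rightarrow> bool" where
  "global_solution f A a \<longleftrightarrow> a \<in> A \<and> (\<forall>b\<in>A. f a \<le> f b)"

definition local_solution :: "('a::topological_space \<Rightarrow> ereal) \<Rightarrow> 'a set \<Rightarrow> 'a \<Rightarrow> bool" where
  "local_solution f A a \<longleftrightarrow> a \<in> A \<and> (\<exists>U. a \<in> interior U \<and> (\<forall>b\<in>A \<inter> U. f a \<le> f b))"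

definition generalized_local_solution ::
    "('a::real_normed_vector \<Rightarrow> ereal) \<Rightarrow> 'a set \<Rightarrow> 'a \<Rightarrow> bool" where
  "generalized_local_solution f A a \<longleftrightarrow> a \<in> closure A \<and>
     (\<exists>U. a \<in> interior U \<and> Inf (barrier f A ` U) = Inf (ACC UNIV (barrier f A) a))"

definition effective_domain :: "('b \<Rightarrow> ereal) \<Rightarrow> 'b set" where
  "effective_domain \<phi> = {y. \<phi> y \<noteq> \<infinity> \<and> \<phi> y \<noteq> -\<infinity>}"

text \<open>
  The partition of the space is an indexed family \<open>P\<close>; its members may be empty.
\<close>

definition indexed_partition :: "'i set \<Rightarrow> ('i \<Rightarrow> 'b set) \<Rightarrow> 'b set \<Rightarrow> bool" where
  "indexed_partition I P S \<longleftrightarrow> disjoint_family_on P I \<and> (\<Union>i\<in>I. P i) = S"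

definition effective_indices :: "('b \<Rightarrow> ereal) \<Rightarrow> 'b set \<Rightarrow> ('a \<Rightarrow> 'b set) \<Rightarrow> 'a set" where
  "effective_indices \<phi> \<Omega> P = {x. P x \<inter> effective_domain \<phi> \<inter> \<Omega> \<noteq> {}}"

definition subproblem_solutions ::
    "('b \<Rightarrow> ereal) \<Rightarrow> 'b set \<Rightarrow> ('a \<Rightarrow> 'b set) \<Rightarrow> 'a \<Rightarrow> 'b set" where
  "subproblem_solutions \<phi> \<Omega> P x = {y. global_solution \<phi> (P x \<inter> \<Omega>) y}"

definition index_function :: "('a \<Rightarrow> 'b set) \<Rightarrow> 'b \<Rightarrow> 'a" where
  "index_function P y = (THE x. y \<in> P x)"

text \<open>
  The value is infinite outside the effective indices, even where \<open>\<phi>\<close> takes the value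
  \<open>-\<infinity>\<close> on \<open>P x \<inter> \<Omega>\<close>: such points do not belong to the effective domain. A comparison of the
  global or local solutions of the two problems therefore needs \<open>\<phi>\<close> to avoid \<open>-\<infinity>\<close> on \<open>\<Omega>\<close>.
\<close>

definition reformulated_objective ::
    "('b \<Rightarrow> ereal) \<Rightarrow> 'b set \<Rightarrow> ('a \<Rightarrow> 'b set) \<Rightarrow> ('a \<Rightarrow> 'b) \<Rightarrow> 'a \<Rightarrow> ereal" where
  "reformulated_objective \<phi> \<Omega> P \<gamma> x =
     (if x \<in> effective_indices \<phi> \<Omega> P then \<phi> (\<gamma> x) else \<infinity>)"

end

theory Submission
  imports Defs
begin

text \<open>
  Write \<open>\<Phi>\<close> for the reformulated objective and \<open>idx\<close> for the index function. Two facts link the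
  problems. The index function is a left inverse of the oracle on the effective indices, and a
  feasible point \<open>y\<close> with \<open>\<phi> y \<noteq> -\<infinity>\<close> satisfies \<open>\<Phi> (idx y) \<le> \<phi> y\<close>
  (\<open>reformulated_objective_index_le\<close>). Hence a lower bound of \<open>\<Phi>\<close> on a set \<open>U\<close> bounds \<open>\<phi>\<close> from
  below at the feasible points of \<open>idx -` U\<close> with value other than \<open>-\<infinity>\<close>, and, \<open>idx\<close> being
  continuous, \<open>idx -` U\<close> is a neighbourhood of every \<open>y\<close> such that \<open>U\<close> is a neighbourhood of
  \<open>idx y\<close>. Taking \<open>y = \<gamma> x\<close> gives the claims on global and local solutions.

  For a generalized local solution \<open>x\<close>, let \<open>m\<close> be the common value of the infimum of \<open>\<Phi>\<close> near
  \<open>x\<close> and of the infimum of its accumulation values at \<open>x\<close>. The latter is attained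
  (\<open>Inf_ACC_attained\<close>), so some sequence of effective indices converges to \<open>x\<close> with values
  converging to \<open>m\<close>. By local finiteness a subsequence stays in one piece of the partition of the
  effective indices; uniform continuity of \<open>\<gamma>\<close> there and completeness make its image converge to
  some \<open>y\<close> (\<open>convergent_image_subsequence\<close>). Then \<open>idx y = x\<close>, the value \<open>m\<close> is an accumulation
  value at \<open>y\<close> of the barrier function of \<open>\<phi>\<close>, and \<open>m\<close> is a lower bound for it near \<open>y\<close>,
  provided that no feasible point near \<open>y\<close> has value \<open>-\<infinity>\<close>. If such points exist arbitrarily near
  \<open>y\<close>, both infima in the definition of a generalized local solution are \<open>-\<infinity>\<close>
  (\<open>generalized_local_solutionI\<close>).
\<close>

section \<open>Accumulation values\<close>

lemma ACC_memI:
  assumes "range s \<subseteq> D" "s \<longlonglongrightarrow> a" "(\<lambda>n. g (s n)) \<longlonglongrightarrow> l"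
  shows "l \<in> ACC D g a"
proof -
  have "l \<in> acc_seq (g \<circ> s)"
    unfolding acc_seq_def using assms(3) strict_mono_id
    by (auto simp: comp_def intro!: exI[of _ id])
  then show ?thesis using assms(1,2) by (auto simp: ACC_def)
qed

lemma ACC_sequence:
  assumes "l \<in> ACC D g a"
  obtains s where "range s \<subseteq> D" "s \<longlonglongrightarrow> a" "(\<lambda>n. g (s n)) \<longlonglongrightarrow> l"
proof -
  from assms obtain s r where s: "range s \<subseteq> D" "s \<longlonglongrightarrow> a" "strict_mono r" "(g \<circ> s \<circ> r) \<longlonglongrightarrow> l"
    by (auto simp: ACC_def acc_seq_def)
  show thesis
  proof (rule that)
    show "range (s \<circ> r) \<subseteq> D" using s(1) by auto
    show "(s \<circ> r) \<longlonglongrightarrow> a" using s(2,3) by (rule LIMSEQ_subseq_LIMSEQ)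
    show "(\<lambda>n. g ((s \<circ> r) n)) \<longlonglongrightarrow> l" using s(4) by (simp add: comp_def)
  qed
qed

lemma eventually_mem_interior:
  assumes "s \<longlonglongrightarrow> a" "a \<in> interior U"
  shows "eventually (\<lambda>n. s n \<in> U) sequentially"
  using topological_tendstoD[OF assms(1) open_interior assms(2)]
  by eventually_elim (use interior_subset in blast)

lemma Inf_image_le_Inf_ACC:
  fixes f :: "'a::topological_space \<Rightarrow> ereal"
  assumes "a \<in> interior U"
  shows "Inf (f ` U) \<le> Inf (ACC UNIV f a)"
proof (rule Inf_greatest)
  fix l assume "l \<in> ACC UNIV f a"
  then obtain s where s: "s \<longlonglongrightarrow> a" "(\<lambda>n. f (s n)) \<longlonglongrightarrow> l"
    by (rule ACC_sequence)
  have "eventually (\<lambda>n. Inf (f ` U) \<le> f (s n)) sequentially"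
    using eventually_mem_interior[OF s(1) assms] by eventually_elim (auto intro: Inf_lower)
  then show "Inf (f ` U) \<le> l"
    using s(2) by (intro tendsto_lowerbound) auto
qed

text \<open>
  The accumulation values include \<open>f a\<close>, which settles the case of infimum \<open>\<infinity>\<close>. Otherwise
  a diagonal argument picks \<open>s n\<close> close to \<open>a\<close> with value below \<open>c n\<close>, where \<open>c\<close> tends from above to
  the infimum, and compactness of the extended reals yields a convergent subsequence of the values.
\<close>

lemma Inf_ACC_attained:
  fixes f :: "'a::metric_space \<Rightarrow> ereal"
  shows "Inf (ACC UNIV f a) \<in> ACC UNIV f a"
proof (cases "Inf (ACC UNIV f a) = \<infinity>")
  case True
  have fa: "f a \<in> ACC UNIV f a"
    by (rule ACC_memI[of "\<lambda>_. a"]) auto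
  then have "Inf (ACC UNIV f a) \<le> f a"
    by (rule Inf_lower)
  with True fa show ?thesis by simp
next
  case False
  define m where "m = Inf (ACC UNIV f a)"
  have "m < \<infinity>" using False by (simp add: m_def less_top)
  then obtain c :: "nat \<Rightarrow> ereal" where c: "\<And>n. m < c n" "c \<longlonglongrightarrow> m"
    using approx_from_above_dense_linorder[of m "\<infinity>"] by blast
  have "\<exists>z. dist z a < 1 / Suc n \<and> f z < c n" for n
  proof -
    obtain l where l: "l \<in> ACC UNIV f a" "l < c n"
      using c(1)[of n] by (auto simp: m_def Inf_less_iff)
    then obtain t where t: "t \<longlonglongrightarrow> a" "(\<lambda>k. f (t k)) \<longlonglongrightarrow> l"
      by (auto elim: ACC_sequence)
    have "eventually (\<lambda>k. dist (t k) a < 1 / Suc n) sequentially"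
      using t(1) by (rule tendstoD) simp
    moreover have "eventually (\<lambda>k. f (t k) < c n) sequentially"
      using t(2) l(2) by (rule order_tendstoD)
    ultimately have "eventually (\<lambda>k. dist (t k) a < 1 / Suc n \<and> f (t k) < c n) sequentially"
      by (rule eventually_conj)
    then show ?thesis
      by (blast dest: eventually_happens'[OF sequentially_bot])
  qed
  then obtain s where s: "\<And>n. dist (s n) a < 1 / Suc n" "\<And>n. f (s n) < c n"
    by metis
  have "(\<lambda>n. dist (s n) a) \<longlonglongrightarrow> 0"
    using s(1)
    by (intro real_tendsto_sandwich[OF _ _ tendsto_const LIMSEQ_Suc[OF lim_1_over_n]] always_eventually)
      (simp_all add: less_imp_le)
  then have s_lim: "s \<longlonglongrightarrow> a" by (rule tendsto_dist_iff[THEN iffD2])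
  obtain l r where r: "strict_mono r" "((\<lambda>n. f (s n)) \<circ> r) \<longlonglongrightarrow> l"
    using compact_complete_linorder[of "\<lambda>n. f (s n)"] by blast
  have "l \<in> ACC UNIV f a"
    using r LIMSEQ_subseq_LIMSEQ[OF s_lim r(1)]
    by (intro ACC_memI[of "s \<circ> r"]) (auto simp: comp_def)
  moreover have "l \<le> m"
    using r(2) LIMSEQ_subseq_LIMSEQ[OF c(2) r(1)] s(2)
    by (intro LIMSEQ_le[of _ l "c \<circ> r" m]) (auto simp: less_imp_le)
  ultimately show ?thesis
    using Inf_lower[of l "ACC UNIV f a"] by (simp add: m_def)
qed

section \<open>Images of convergent sequences under piecewise uniformly continuous maps\<close>

text \<open>
  The limit \<open>x\<close> need not lie in the union of the pieces, so continuity of \<open>g\<close> on each piece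
  would not suffice: it is uniform continuity that preserves Cauchy sequences.
\<close>

lemma convergent_image_subsequence:
  fixes g :: "'a::metric_space \<Rightarrow> 'b::complete_space"
  assumes s: "s \<longlonglongrightarrow> x" "range s \<subseteq> (\<Union>i\<in>I. S i)"
    and U: "x \<in> interior U" "finite {i \<in> I. S i \<inter> U \<noteq> {}}"
    and g: "\<And>i. i \<in> I \<Longrightarrow> uniformly_continuous_on (S i) g"
  obtains r y where "strict_mono r" "(\<lambda>n. g (s (r n))) \<longlonglongrightarrow> y"
proof -
  have "eventually (\<lambda>n. \<exists>i\<in>{i \<in> I. S i \<inter> U \<noteq> {}}. s n \<in> S i) sequentially"
    using eventually_mem_interior[OF s(1) U(1)]
    by eventually_elim (use s(2) in blast)
  then have "frequently (\<lambda>n. \<exists>i\<in>{i \<in> I. S i \<inter> U \<noteq> {}}. s n \<in> S i) sequentially"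
    by (rule eventually_frequently[OF sequentially_bot])
  then obtain i where i: "i \<in> I" "frequently (\<lambda>n. s n \<in> S i) sequentially"
    unfolding frequently_bex_finite_distrib[OF U(2)] by blast
  then have inf: "infinite {n. s n \<in> S i}"
    by (simp add: INFM_iff_infinite frequently_cofinite flip: cofinite_eq_sequentially)
  then obtain r :: "nat \<Rightarrow> nat" where r: "strict_mono r" "\<And>n. s (r n) \<in> S i"
    using infinite_enumerate by blast
  have "Cauchy (\<lambda>n. s (r n))"
    using LIMSEQ_imp_Cauchy[OF LIMSEQ_subseq_LIMSEQ[OF s(1) r(1)]] by (simp add: comp_def)
  then have "Cauchy (\<lambda>n. g (s (r n)))"
    using uniformly_continuous_on_Cauchy[OF g[OF i(1)]] r(2) by blast
  then obtain y where "(\<lambda>n. g (s (r n))) \<longlonglongrightarrow> y"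
    using Cauchy_convergent convergent_def by blast
  with r(1) that show thesis by blast
qed

section \<open>The index function and the reformulated objective\<close>

lemma index_function_eq:
  assumes "indexed_partition UNIV P UNIV" "y \<in> P x"
  shows "index_function P y = x"
  unfolding index_function_def
proof (rule the_equality)
  fix z assume "y \<in> P z"
  with assms show "z = x"
    by (auto simp: indexed_partition_def disjoint_family_on_def)
qed (fact assms(2))

lemma mem_index_function:
  assumes "indexed_partition UNIV P UNIV"
  shows "y \<in> P (index_function P y)"
proof -
  obtain x where "y \<in> P x"
    using assms by (auto simp: indexed_partition_def)
  with index_function_eq[OF assms this] show ?thesis by simp
qed

text \<open>
  The inequality can fail when \<open>\<phi> y = -\<infinity>\<close>: if \<open>\<phi>\<close> is \<open>-\<infinity>\<close> on all feasible points of the member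
  of the partition that contains \<open>y\<close>, then the index of \<open>y\<close> is not effective, and the reformulated
  objective is \<open>\<infinity>\<close> there.
\<close>

lemma reformulated_objective_index_le:
  assumes "indexed_partition UNIV P UNIV"
    and "\<forall>x \<in> effective_indices \<phi> \<Omega> P. \<gamma> x \<in> subproblem_solutions \<phi> \<Omega> P x"
    and "y \<in> \<Omega>" "\<phi> y \<noteq> -\<infinity>"
  shows "reformulated_objective \<phi> \<Omega> P \<gamma> (index_function P y) \<le> \<phi> y"
proof (cases "\<phi> y = \<infinity>")
  case False
  let ?x = "index_function P y"
  have y: "y \<in> P ?x" by (rule mem_index_function[OF assms(1)])
  then have x: "?x \<in> effective_indices \<phi> \<Omega> P"
    using False assms(3,4) by (auto simp: effective_indices_def effective_domain_def)
  with assms(2) have "\<gamma> ?x \<in> subproblem_solutions \<phi> \<Omega> P ?x" by blast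
  with x y assms(3) show ?thesis
    by (simp add: reformulated_objective_def subproblem_solutions_def global_solution_def)
qed simp

section \<open>Solutions of the two problems\<close>

text \<open>
  The lower bound is required only where the value is not \<open>-\<infinity>\<close>. If points with value \<open>-\<infinity>\<close>
  accumulate at \<open>a\<close>, then \<open>-\<infinity>\<close> is an accumulation value and any neighbourhood will do; otherwise
  \<open>V\<close> can be shrunk to avoid them.
\<close>

lemma generalized_local_solutionI:
  assumes "a \<in> closure A"
    and V: "a \<in> interior V" "\<And>b. b \<in> V \<Longrightarrow> b \<in> A \<Longrightarrow> f b \<noteq> -\<infinity> \<Longrightarrow> m \<le> f b"
    and s: "range s \<subseteq> A" "s \<longlonglongrightarrow> a" "(\<lambda>n. f (s n)) \<longlonglongrightarrow> m"
  shows "generalized_local_solution f A a"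
proof -
  let ?g = "barrier f A"
  have "\<exists>W. a \<in> interior W \<and> Inf (ACC UNIV ?g a) \<le> Inf (?g ` W)"
  proof (cases "a \<in> closure {b \<in> A. f b = -\<infinity>}")
    case True
    then obtain t where t: "\<And>n. t n \<in> A \<and> f (t n) = -\<infinity>" "t \<longlonglongrightarrow> a"
      by (auto simp: closure_sequential)
    have "-\<infinity> \<in> ACC UNIV ?g a"
      using t by (intro ACC_memI[of t]) (auto simp: barrier_def)
    then have "Inf (ACC UNIV ?g a) = -\<infinity>"
      using Inf_lower by fastforce
    then show ?thesis by (intro exI[of _ UNIV]) simp
  next
    case False
    define W where "W = V - closure {b \<in> A. f b = -\<infinity>}"
    have "m \<in> ACC UNIV ?g a"
      using s by (intro ACC_memI[of s]) (auto simp: barrier_def image_subset_iff)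
    then have "Inf (ACC UNIV ?g a) \<le> m" by (rule Inf_lower)
    also have "m \<le> Inf (?g ` W)"
    proof (rule INF_greatest)
      fix b assume b: "b \<in> W"
      then have "f b \<noteq> -\<infinity>" if "b \<in> A"
        using that closure_subset[of "{b \<in> A. f b = -\<infinity>}"] by (auto simp: W_def)
      with b V(2)[of b] show "m \<le> ?g b"
        by (auto simp: barrier_def W_def)
    qed
    finally have "Inf (ACC UNIV ?g a) \<le> Inf (?g ` W)" .
    moreover have "a \<in> interior W"
      using V(1) False by (simp add: W_def interior_diff interior_open)
    ultimately show ?thesis by blast
  qed
  then obtain W where "a \<in> interior W" "Inf (ACC UNIV ?g a) \<le> Inf (?g ` W)" by blast
  with Inf_image_le_Inf_ACC[of a W ?g] assms(1) show ?thesis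
    unfolding generalized_local_solution_def by (blast intro: antisym)
qed

theorem theorem1:
  fixes \<phi> :: "'b::banach \<Rightarrow> ereal"
    and \<Omega> :: "'b set"
    and P :: "'a::real_normed_vector \<Rightarrow> 'b set"
    and \<gamma> :: "'a \<Rightarrow> 'b"
    and N :: enat
    and Xs :: "nat \<Rightarrow> 'a set"
  assumes fin_dim: "\<exists>B :: 'a set. finite B \<and> span B = UNIV"
    and feasible: "effective_domain \<phi> \<inter> \<Omega> \<noteq> {}"
    and partition: "indexed_partition UNIV P UNIV"
    and solvable: "\<forall>x \<in> effective_indices \<phi> \<Omega> P. subproblem_solutions \<phi> \<Omega> P x \<noteq> {}"
    and gamma_solution: "\<forall>x \<in> effective_indices \<phi> \<Omega> P.
                   \<gamma> x \<in> effective_domain \<phi> \<and> \<gamma> x \<in> subproblem_solutions \<phi> \<Omega> P x"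
    and index_continuous: "continuous_on UNIV (index_function P)"
    and N_pos: "1 \<le> N"
    and X_partition: "indexed_partition {i. 1 \<le> i \<and> enat i \<le> N} Xs (effective_indices \<phi> \<Omega> P)"
    and X_locally_finite: "\<forall>x \<in> closure (effective_indices \<phi> \<Omega> P).
                   \<exists>U. x \<in> interior U \<and> finite {i. 1 \<le> i \<and> enat i \<le> N \<and> Xs i \<inter> U \<noteq> {}}"
    and gamma_unif_cont: "\<forall>i. 1 \<le> i \<and> enat i \<le> N \<longrightarrow> uniformly_continuous_on (Xs i) \<gamma>"
  shows "((\<forall>y\<in>\<Omega>. \<phi> y \<noteq> -\<infinity>) \<longrightarrow>
            (\<forall>x. global_solution (reformulated_objective \<phi> \<Omega> P \<gamma>) UNIV x \<longrightarrow>
                 x \<in> effective_indices \<phi> \<Omega> P \<and> global_solution \<phi> \<Omega> (\<gamma> x))) \<and>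
         ((\<forall>y\<in>\<Omega>. \<phi> y \<noteq> -\<infinity>) \<longrightarrow>
            (\<forall>x \<in> effective_indices \<phi> \<Omega> P.
                 local_solution (reformulated_objective \<phi> \<Omega> P \<gamma>) UNIV x \<longrightarrow>
                 local_solution \<phi> \<Omega> (\<gamma> x))) \<and>
         (\<forall>x \<in> closure (effective_indices \<phi> \<Omega> P).
                 generalized_local_solution (reformulated_objective \<phi> \<Omega> P \<gamma>) UNIV x \<longrightarrow>
                 (\<exists>y \<in> ACC (effective_indices \<phi> \<Omega> P) \<gamma> x. generalized_local_solution \<phi> \<Omega> y))"
proof -
  define X where "X = effective_indices \<phi> \<Omega> P"
  define idx where "idx = index_function P"
  define \<Phi> where "\<Phi> = reformulated_objective \<phi> \<Omega> P \<gamma>"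
  have \<gamma>: "\<gamma> x \<in> effective_domain \<phi>" "\<gamma> x \<in> \<Omega>" "\<gamma> x \<in> P x" if "x \<in> X" for x
    using that gamma_solution
    by (auto simp: X_def subproblem_solutions_def global_solution_def)
  have idx_\<gamma>: "idx (\<gamma> x) = x" if "x \<in> X" for x
    unfolding idx_def using partition \<gamma>(3)[OF that] by (rule index_function_eq)
  have \<Phi>_in: "\<Phi> x = \<phi> (\<gamma> x)" "\<Phi> x \<noteq> \<infinity>" if "x \<in> X" for x
    using that \<gamma>(1)[OF that]
    by (auto simp: \<Phi>_def X_def reformulated_objective_def effective_domain_def)
  have \<Phi>_out: "\<Phi> x = \<infinity>" if "x \<notin> X" for x
    using that by (simp add: \<Phi>_def X_def reformulated_objective_def)
  have \<Phi>_le: "\<Phi> (idx y) \<le> \<phi> y" if "y \<in> \<Omega>" "\<phi> y \<noteq> -\<infinity>" for y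
    unfolding \<Phi>_def idx_def using gamma_solution that
    by (intro reformulated_objective_index_le[OF partition]) auto
  have nbhd: "y \<in> interior (idx -` U)" if "idx y \<in> interior U" for y U
  proof (rule interiorI)
    show "open (idx -` interior U)"
      using open_interior index_continuous unfolding idx_def by (rule open_vimage)
    show "idx -` interior U \<subseteq> idx -` U" using interior_subset by blast
  qed (use that in simp)

  have "x \<in> X \<and> global_solution \<phi> \<Omega> (\<gamma> x)"
    if fin: "\<forall>y\<in>\<Omega>. \<phi> y \<noteq> -\<infinity>" and x: "global_solution \<Phi> UNIV x" for x
  proof -
    have le: "\<Phi> x \<le> \<Phi> z" for z
      using x by (simp add: global_solution_def)
    obtain y where "y \<in> effective_domain \<phi>" "y \<in> \<Omega>" using feasible by blast
    then have "idx y \<in> X"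
      using mem_index_function[OF partition, of y] by (auto simp: X_def idx_def effective_indices_def)
    then have "x \<in> X"
      using le[of "idx y"] \<Phi>_in(2)[of "idx y"] \<Phi>_out[of x] by fastforce
    moreover have "\<phi> (\<gamma> x) \<le> \<phi> z" if "z \<in> \<Omega>" for z
      using le[of "idx z"] \<Phi>_le[OF that] fin that \<Phi>_in(1)[OF \<open>x \<in> X\<close>] by auto
    ultimately show ?thesis
      using \<gamma>(2) by (simp add: global_solution_def)
  qed

  moreover have "local_solution \<phi> \<Omega> (\<gamma> x)"
    if fin: "\<forall>y\<in>\<Omega>. \<phi> y \<noteq> -\<infinity>" and x: "x \<in> X" "local_solution \<Phi> UNIV x" for x
  proof -
    obtain U where U: "x \<in> interior U" "\<And>z. z \<in> U \<Longrightarrow> \<Phi> x \<le> \<Phi> z"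
      using x(2) by (auto simp: local_solution_def)
    have "\<phi> (\<gamma> x) \<le> \<phi> z" if "z \<in> \<Omega>" "idx z \<in> U" for z
      using U(2)[OF that(2)] \<Phi>_le[OF that(1)] fin that(1) \<Phi>_in(1)[OF x(1)] by auto
    moreover have "\<gamma> x \<in> interior (idx -` U)"
      using U(1) idx_\<gamma>[OF x(1)] by (intro nbhd) simp
    ultimately show ?thesis
      using \<gamma>(2)[OF x(1)] unfolding local_solution_def by blast
  qed

  moreover have "\<exists>y \<in> ACC X \<gamma> x. generalized_local_solution \<phi> \<Omega> y"
    if cl: "x \<in> closure X" and x: "generalized_local_solution \<Phi> UNIV x" for x
  proof -
    have "barrier \<Phi> UNIV = \<Phi>" by (simp add: barrier_def fun_eq_iff)
    with x obtain U where U: "x \<in> interior U" "Inf (\<Phi> ` U) = Inf (ACC UNIV \<Phi> x)"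
      by (auto simp: generalized_local_solution_def)
    define m where "m = Inf (\<Phi> ` U)"
    have m_le: "m \<le> \<Phi> z" if "z \<in> U" for z
      using that by (auto simp: m_def intro: Inf_lower)
    obtain z where "z \<in> X" "z \<in> U"
      using cl U(1) interior_subset[of U] open_interior[of U]
      by (metis (no_types) closure_iff_nhds_not_empty disjoint_iff subset_iff)
    then have "m < \<infinity>"
      using m_le[of z] \<Phi>_in(2)[of z] by (auto simp: less_top)
    have "m \<in> ACC UNIV \<Phi> x"
      using Inf_ACC_attained[of \<Phi> x] U(2) by (simp add: m_def)
    then obtain t where t: "t \<longlonglongrightarrow> x" "(\<lambda>n. \<Phi> (t n)) \<longlonglongrightarrow> m"
      by (rule ACC_sequence)
    \<comment> \<open>The objective is infinite off \<open>X\<close>, so a sequence with values tending to \<open>m < \<infinity>\<close> ends up in \<open>X\<close>.\<close>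
    have "eventually (\<lambda>n. t n \<in> X) sequentially"
      using order_tendstoD(2)[OF t(2) \<open>m < \<infinity>\<close>] by eventually_elim (use \<Phi>_out in fastforce)
    then obtain k where k: "\<And>n. t (n + k) \<in> X"
      unfolding eventually_sequentially by (metis le_add2)
    define s where "s = (\<lambda>n. t (n + k))"
    have s: "\<And>n. s n \<in> X" "s \<longlonglongrightarrow> x" "(\<lambda>n. \<Phi> (s n)) \<longlonglongrightarrow> m"
      using k LIMSEQ_ignore_initial_segment[OF t(1)] LIMSEQ_ignore_initial_segment[OF t(2)]
      by (auto simp: s_def)
    let ?I = "{i. 1 \<le> i \<and> enat i \<le> N}"
    obtain W where W: "x \<in> interior W" "finite {i \<in> ?I. Xs i \<inter> W \<noteq> {}}"
      using X_locally_finite cl by (auto simp: X_def conj_assoc)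
    have s_pieces: "range s \<subseteq> (\<Union>i\<in>?I. Xs i)"
      using s(1) X_partition by (auto simp: X_def indexed_partition_def)
    obtain r y where r: "strict_mono r" and y: "(\<lambda>n. \<gamma> (s (r n))) \<longlonglongrightarrow> y"
      using gamma_unif_cont by (auto intro: convergent_image_subsequence[OF s(2) s_pieces W, of \<gamma>])
    have sr: "(\<lambda>n. s (r n)) \<longlonglongrightarrow> x" "(\<lambda>n. \<Phi> (s (r n))) \<longlonglongrightarrow> m"
      using LIMSEQ_subseq_LIMSEQ[OF s(2) r] LIMSEQ_subseq_LIMSEQ[OF s(3) r]
      by (simp_all add: comp_def)
    have "(\<lambda>n. idx (\<gamma> (s (r n)))) \<longlonglongrightarrow> idx y"
      using index_continuous y unfolding idx_def
      by (rule continuous_on_tendsto_compose) auto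
    then have "idx y = x"
      using idx_\<gamma>[OF s(1)] sr(1) by (auto intro: LIMSEQ_unique)
    have "generalized_local_solution \<phi> \<Omega> y"
    proof (rule generalized_local_solutionI)
      show "y \<in> closure \<Omega>"
        using y \<gamma>(2)[OF s(1)]
        by (auto simp: closure_sequential intro!: exI[of _ "\<lambda>n. \<gamma> (s (r n))"])
      show "y \<in> interior (idx -` U)"
        using U(1) \<open>idx y = x\<close> by (intro nbhd) simp
      show "m \<le> \<phi> b" if "b \<in> idx -` U" "b \<in> \<Omega>" "\<phi> b \<noteq> -\<infinity>" for b
        using m_le[of "idx b"] \<Phi>_le[of b] that by auto
      show "range (\<lambda>n. \<gamma> (s (r n))) \<subseteq> \<Omega>"
        using \<gamma>(2)[OF s(1)] by auto
      show "(\<lambda>n. \<phi> (\<gamma> (s (r n)))) \<longlonglongrightarrow> m"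
        using sr(2) \<Phi>_in(1)[OF s(1)] by simp
    qed (fact y)
    moreover have "y \<in> ACC X \<gamma> x"
      using s(1) sr(1) y by (intro ACC_memI[of "\<lambda>n. s (r n)"]) auto
    ultimately show ?thesis by blast
  qed

  ultimately show ?thesis
    unfolding X_def \<Phi>_def by blast
qed

end
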